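(* Let $\mathcal{A}=(Q,\delta,\Sigma,s)$ be an NFA, let $\mathcal{A}/_{\sim_{FS}}=(Q/_{\sim_{FS}},\delta/_{\sim_{FS}},\Sigma,s/_{\sim_{FS}})$ be the quotient automaton of $\mathcal{A}$ such that $Q/_{\sim_{FS}}$ is the coarsest forward-stable partition for $\mathcal{A}$, and let $\leq_{R}'$ be the maximum co-lex relation of $\mathcal{A}/_{\sim_{FS}}$. Then $\leq_{R}'$ is the maximum co-lex order of $\mathcal{A}/_{\sim_{FS}}$.
   Context: NFA: a tuple $(Q,\delta,\Sigma,s)$ with finite state set $Q$, finite alphabet $\Sigma$, transition function $\delta:Q\times\Sigma\to 2^Q$ and initial state $s\in Q$ (no set of final states). Standing assumptions: every state is reachable from $s$; $s$ has no incoming edges; every character of $\Sigma$ labels at least one transition. Write $\delta_a(u)=\delta(u,a)$ and $\delta_a(S)=\bigcup_{u\in S}\delta_a(u)$ for $S\subseteq Q$. The set $\Sigma\cup\{\#\}$ ($\#\notin\Sigma$) carries a fixed total order with $\#<a$ for all $a\in\Sigma$. For $u\ne s$, $\lambda(u)\subseteq\Sigma$ is the set of labels of edges entering $u$; $\lambda(s)=\{\#\}$. $\lambda(u)\le\lambda(v)$ means $a\le a'$ for all $a\in\lambda(u)$, $a'\in\lambda(v)$. Forward-stability: for $S,T\subseteq Q$, $S$ is forward-stable w.r.t. $T$ if for every $a\in\Sigma$ either $S\subseteq\delta_a(T)$ or $S\cap\delta_a(T)=\emptyset$. A partition of $Q$ is forward-stable for $\mathcal{A}$ if each part is forward-stable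 w.r.t. each part. The coarsest forward-stable partition is the unique forward-stable partition of which every forward-stable partition is a refinement (it always exists). $\sim_{FS}$ is the equivalence on $Q$ whose classes are its parts. Quotient automaton: for an equivalence relation $\sim$ on $Q$, $\mathcal{A}/_\sim=(Q/_\sim,\delta/_\sim,\Sigma,s/_\sim)$ with $s/_\sim=[s]_\sim$, where $[v]_\sim\in\delta/_\sim([u]_\sim,a)$ iff there are $u'\in[u]_\sim$, $v'\in[v]_\sim$ with $v'\in\delta(u',a)$. Co-lex order of an NFA: a partial order $\le$ on its states such that (1) $u<v$ (i.e. $u\le v$ and not $v\le u$) implies $\lambda(u)\le\lambda(v)$; (2) whenever $u\in\delta_a(u')$, $v\in\delta_a(v')$ and $u<v$, then $u'\le v'$. A maximum co-lex order is a co-lex order equal to the union of all co-lex orders (it need not exist for a general NFA). Co-lex relation of an NFA: a reflexive relation $R$ on its states such that (1) for $u\ne v$, $(u,v)\in R$ implies $\lambda(u)\le\lambda(v)$; (2) for $u\in\delta_a(u')$, $v\in\delta_a(v')$ with $u\neq v$, $(u,v)\in R$ implies $(u',v')\in R$. The maximum co-lex relation is the union of all co-lex relations; it always is itself a co-lex relation and a partial preorder (reflexive and transitive). *)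

theory Defs
  imports Main "HOL-Library.Disjoint_Sets" "HOL-Library.Option_ord"
begin

text \<open>
  The alphabet is a finite subset of a linearly ordered type. The set of characters extended by
  the extra minimal symbol is modelled by \<^typ>\<open>'a option\<close>: \<^term>\<open>None\<close> is the extra symbol, and
  the order of \<^theory>\<open>HOL-Library.Option_ord\<close> puts it strictly below every \<^term>\<open>Some a\<close>.
\<close>

record ('q, 'a) nfa =
  states :: "'q set"
  delta :: "'q \<Rightarrow> 'a \<Rightarrow> 'q set"
  alphabet :: "'a set"
  start :: 'q

definition delta_set :: "('q, 'a) nfa \<Rightarrow> 'a \<Rightarrow> 'q set \<Rightarrow> 'q set" where
  "delta_set A a S = (\<Union>u\<in>S. delta A u a)"

definition edge_rel :: "('q, 'a) nfa \<Rightarrow> ('q \<times> 'q) set" where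
  "edge_rel A = {(u, v). u \<in> states A \<and> (\<exists>a\<in>alphabet A. v \<in> delta A u a)}"

text \<open>
  The transition function is a total HOL function, but only its values on
  \<^term>\<open>states A\<close> and \<^term>\<open>alphabet A\<close> are meaningful.
\<close>

definition is_nfa :: "('q, 'a) nfa \<Rightarrow> bool" where
  "is_nfa A \<longleftrightarrow>
     finite (states A) \<and> finite (alphabet A) \<and> start A \<in> states A \<and>
     (\<forall>u\<in>states A. \<forall>a\<in>alphabet A. delta A u a \<subseteq> states A) \<and>
     (\<forall>u\<in>states A. (start A, u) \<in> (edge_rel A)\<^sup>*) \<and>
     (\<forall>u\<in>states A. \<forall>a\<in>alphabet A. start A \<notin> delta A u a) \<and>
     (\<forall>a\<in>alphabet A. \<exists>u\<in>states A. delta A u a \<noteq> {})"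

definition in_labels :: "('q, 'a) nfa \<Rightarrow> 'q \<Rightarrow> 'a option set" where
  "in_labels A u =
     (if u = start A then {None}
      else {Some a | a. a \<in> alphabet A \<and> (\<exists>u'\<in>states A. u \<in> delta A u' a)})"

definition labels_le :: "('a::linorder) option set \<Rightarrow> 'a option set \<Rightarrow> bool" where
  "labels_le L M \<longleftrightarrow> (\<forall>x\<in>L. \<forall>y\<in>M. x \<le> y)"

definition forward_stable_wrt :: "('q, 'a) nfa \<Rightarrow> 'q set \<Rightarrow> 'q set \<Rightarrow> bool" where
  "forward_stable_wrt A S T \<longleftrightarrow>
     (\<forall>a\<in>alphabet A. S \<subseteq> delta_set A a T \<or> S \<inter> delta_set A a T = {})"

definition forward_stable_partition :: "('q, 'a) nfa \<Rightarrow> 'q set set \<Rightarrow> bool" where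
  "forward_stable_partition A P \<longleftrightarrow>
     partition_on (states A) P \<and> (\<forall>S\<in>P. \<forall>T\<in>P. forward_stable_wrt A S T)"

definition is_coarsest_fs_partition :: "('q, 'a) nfa \<Rightarrow> 'q set set \<Rightarrow> bool" where
  "is_coarsest_fs_partition A P \<longleftrightarrow>
     forward_stable_partition A P \<and>
     (\<forall>P'. forward_stable_partition A P' \<longrightarrow> refines (states A) P' P)"

definition coarsest_fs_partition :: "('q, 'a) nfa \<Rightarrow> 'q set set" where
  "coarsest_fs_partition A = (THE P. is_coarsest_fs_partition A P)"

definition part_equiv :: "'q set set \<Rightarrow> ('q \<times> 'q) set" where
  "part_equiv P = {(u, v). \<exists>X\<in>P. u \<in> X \<and> v \<in> X}"

definition fs_equiv :: "('q, 'a) nfa \<Rightarrow> ('q \<times> 'q) set" where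
  "fs_equiv A = part_equiv (coarsest_fs_partition A)"

text \<open>The definite description in \<^const>\<open>coarsest_fs_partition\<close> always denotes:\<close>

lemma part_equiv_equiv:
  assumes "partition_on B P"
  shows "equiv B (part_equiv P)"
  using equiv_partition_on[OF assms] unfolding part_equiv_def by auto

lemma ex1_coarsest_fs_partition: "\<exists>!P. is_coarsest_fs_partition A P"
proof (rule ex_ex1I)
  define C where "C = {P. forward_stable_partition A P}"
  define U where "U = (\<Union>P\<in>C. part_equiv P)"
  define r where "r = U\<^sup>+"
  have part: "partition_on (states A) P" if "P \<in> C" for P
    using that by (simp add: C_def forward_stable_partition_def)
  note eqs = part_equiv_equiv[OF part]
  have singles: "(\<lambda>x. {x}) ` states A \<in> C"
    unfolding C_def forward_stable_partition_def forward_stable_wrt_def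
    by (auto simp: partition_on_singletons)
  have U_sub: "U \<subseteq> states A \<times> states A"
    using eqs unfolding U_def equiv_def by blast
  have eqr: "equiv (states A) r"
  proof (rule equivI)
    show "r \<subseteq> states A \<times> states A"
      unfolding r_def using U_sub by (rule trancl_subset_Sigma)
    show "refl_on (states A) r"
      using singles unfolding r_def U_def refl_on_def part_equiv_def by blast
    have "sym U"
      unfolding U_def sym_def part_equiv_def by blast
    then show "sym r"
      unfolding r_def by (rule sym_trancl)
    show "trans r"
      unfolding r_def by (rule trans_trancl)
  qed
  have step: "z \<in> delta_set A a T"
    if T: "T \<in> states A // r" and a: "a \<in> alphabet A"
      and w: "w \<in> delta_set A a T" and wz: "(w, z) \<in> U" for T a w z
  proof -
    obtain P where P: "P \<in> C" and "(w, z) \<in> part_equiv P"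
      using wz unfolding U_def by blast
    then obtain X where X: "X \<in> P" "w \<in> X" "z \<in> X"
      unfolding part_equiv_def by blast
    obtain t where t: "t \<in> T" "w \<in> delta A t a"
      using w unfolding delta_set_def by blast
    have "t \<in> states A"
      using in_quotient_imp_subset[OF eqr T] t(1) by blast
    then obtain Y where Y: "Y \<in> P" "t \<in> Y"
      using part[OF P] unfolding partition_on_def by blast
    have "Y \<subseteq> T"
    proof
      fix y assume "y \<in> Y"
      then have "(t, y) \<in> r"
        using P Y unfolding r_def U_def part_equiv_def by blast
      then show "y \<in> T"
        by (rule in_quotient_imp_closed[OF eqr T t(1)])
    qed
    moreover have "X \<subseteq> delta_set A a Y"
    proof -
      have "w \<in> X \<inter> delta_set A a Y"
        using X t Y unfolding delta_set_def by blast
      then show ?thesis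
        using P X(1) Y(1) a
        unfolding C_def forward_stable_partition_def forward_stable_wrt_def by blast
    qed
    ultimately show ?thesis
      using X(3) unfolding delta_set_def by blast
  qed
  have stable: "forward_stable_wrt A S T"
    if S: "S \<in> states A // r" and T: "T \<in> states A // r" for S T
    unfolding forward_stable_wrt_def
  proof (intro ballI disjCI subsetI)
    fix a y
    assume a: "a \<in> alphabet A" and ne: "S \<inter> delta_set A a T \<noteq> {}" and y: "y \<in> S"
    obtain x where x: "x \<in> S" "x \<in> delta_set A a T"
      using ne by blast
    have "(x, y) \<in> U\<^sup>+"
      using quotient_eq_iff[OF eqr S S x(1) y] by (simp add: r_def)
    then show "y \<in> delta_set A a T"
      by (induction rule: trancl_induct) (use step[OF T a] x(2) in blast)+
  qed
  have "forward_stable_partition A (states A // r)"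
    unfolding forward_stable_partition_def
    using partition_on_quotient[OF eqr] stable by blast
  moreover have "refines (states A) P (states A // r)" if "forward_stable_partition A P" for P
  proof -
    have P: "P \<in> C" using that by (simp add: C_def)
    have "\<exists>Y\<in>states A // r. X \<subseteq> Y" if X: "X \<in> P" for X
    proof -
      obtain x where x: "x \<in> X" "x \<in> states A"
        using part[OF P] X unfolding partition_on_def by (metis UnionI ex_in_conv)
      have "X \<subseteq> r `` {x}"
        using P X x unfolding r_def U_def part_equiv_def by blast
      then show ?thesis
        using quotientI[OF x(2)] by blast
    qed
    then show ?thesis
      unfolding refines_def using part[OF P] partition_on_quotient[OF eqr] by blast
  qed
  ultimately show "\<exists>P. is_coarsest_fs_partition A P"
    unfolding is_coarsest_fs_partition_def by blast
next
  fix P P'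
  assume "is_coarsest_fs_partition A P" "is_coarsest_fs_partition A P'"
  then show "P = P'"
    unfolding is_coarsest_fs_partition_def by (meson refines_asym)
qed

definition quotient_nfa :: "('q, 'a) nfa \<Rightarrow> ('q \<times> 'q) set \<Rightarrow> ('q set, 'a) nfa" where
  "quotient_nfa A r =
     \<lparr>states = states A // r,
      delta = (\<lambda>X a. {Y \<in> states A // r. \<exists>u'\<in>X. \<exists>v'\<in>Y. v' \<in> delta A u' a}),
      alphabet = alphabet A,
      start = r `` {start A}\<rparr>"

text \<open>A pair \<^term>\<open>(u, v)\<close> in the relation means that \<^term>\<open>u\<close> is below \<^term>\<open>v\<close>.\<close>

definition colex_order :: "('q, 'a::linorder) nfa \<Rightarrow> ('q \<times> 'q) set \<Rightarrow> bool" where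
  "colex_order A R \<longleftrightarrow>
     partial_order_on (states A) R \<and>
     (\<forall>u v. (u, v) \<in> R \<and> (v, u) \<notin> R \<longrightarrow> labels_le (in_labels A u) (in_labels A v)) \<and>
     (\<forall>a\<in>alphabet A. \<forall>u'\<in>states A. \<forall>v'\<in>states A. \<forall>u\<in>delta A u' a. \<forall>v\<in>delta A v' a.
        (u, v) \<in> R \<and> (v, u) \<notin> R \<longrightarrow> (u', v') \<in> R)"

definition maximum_colex_order :: "('q, 'a::linorder) nfa \<Rightarrow> ('q \<times> 'q) set \<Rightarrow> bool" where
  "maximum_colex_order A R \<longleftrightarrow> colex_order A R \<and> R = \<Union>{R'. colex_order A R'}"

definition colex_relation :: "('q, 'a::linorder) nfa \<Rightarrow> ('q \<times> 'q) set \<Rightarrow> bool" where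
  "colex_relation A R \<longleftrightarrow>
     R \<subseteq> states A \<times> states A \<and> refl_on (states A) R \<and>
     (\<forall>u v. u \<noteq> v \<and> (u, v) \<in> R \<longrightarrow> labels_le (in_labels A u) (in_labels A v)) \<and>
     (\<forall>a\<in>alphabet A. \<forall>u'\<in>states A. \<forall>v'\<in>states A. \<forall>u\<in>delta A u' a. \<forall>v\<in>delta A v' a.
        u \<noteq> v \<and> (u, v) \<in> R \<longrightarrow> (u', v') \<in> R)"

definition maximum_colex_relation :: "('q, 'a::linorder) nfa \<Rightarrow> ('q \<times> 'q) set" where
  "maximum_colex_relation A = \<Union>{R. colex_relation A R}"

end

theory Submission
  imports Defs
begin

text \<open>
  The composition of the maximum co-lex relation with itself is again co-lex: if two states are
  reached by \<open>a\<close>, then so is every state between them, because its labels are squeezed to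
  \<open>{a}\<close>. Hence the maximum co-lex relation of any NFA is a preorder, and only antisymmetry is
  special to the quotient. There, the symmetric part of the preorder, pulled back to the states of
  the original automaton, is a forward-stable equivalence (by the same squeezing argument), so it
  is contained in the coarsest one and mutually comparable classes coincide.
\<close>

section \<open>Forward-stable equivalences and the coarsest partition\<close>

text \<open>Edgewise form of forward-stability: \<open>r\<close> is a bisimulation for the reversed
  transitions. Working with pairs instead of parts lets edges be transported along \<open>r\<close>
  directly.\<close>

definition forward_stable_equiv :: "('q, 'a) nfa \<Rightarrow> ('q \<times> 'q) set \<Rightarrow> bool" where
  "forward_stable_equiv A r \<longleftrightarrow>
     equiv (states A) r \<and>
     (\<forall>a\<in>alphabet A. \<forall>u\<in>states A. \<forall>v\<in>delta A u a. \<forall>v'. (v, v') \<in> r \<longrightarrow>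
        (\<exists>u'. (u, u') \<in> r \<and> v' \<in> delta A u' a))"

lemma forward_stable_equivE:
  assumes "forward_stable_equiv A r"
    and "a \<in> alphabet A" "u \<in> states A" "v \<in> delta A u a" "(v, v') \<in> r"
  obtains u' where "(u, u') \<in> r" "u' \<in> states A" "v' \<in> delta A u' a"
  using assms unfolding forward_stable_equiv_def equiv_def by blast

lemma is_coarsest_fs_partition_coarsest: "is_coarsest_fs_partition A (coarsest_fs_partition A)"
  unfolding coarsest_fs_partition_def by (rule theI'[OF ex1_coarsest_fs_partition])

lemma forward_stable_equiv_fs_equiv: "forward_stable_equiv A (fs_equiv A)"
proof -
  let ?P = "coarsest_fs_partition A"
  have P: "partition_on (states A) ?P"
    and stable: "\<And>S T. S \<in> ?P \<Longrightarrow> T \<in> ?P \<Longrightarrow> forward_stable_wrt A S T"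
    using is_coarsest_fs_partition_coarsest[of A]
    unfolding is_coarsest_fs_partition_def forward_stable_partition_def by blast+
  have "\<exists>u'. (u, u') \<in> fs_equiv A \<and> v' \<in> delta A u' a"
    if a: "a \<in> alphabet A" and u: "u \<in> states A" and v: "v \<in> delta A u a"
      and vv': "(v, v') \<in> fs_equiv A" for a u v v'
  proof -
    obtain S where S: "S \<in> ?P" "v \<in> S" "v' \<in> S"
      using vv' unfolding fs_equiv_def part_equiv_def by blast
    obtain T where T: "T \<in> ?P" "u \<in> T"
      using u P unfolding partition_on_def by blast
    \<comment> \<open>The part \<open>S\<close> of \<open>v\<close> meets the
      \<open>a\<close>-successors of \<open>T\<close>, so stability puts all of \<open>S\<close>,
      including \<open>v'\<close>, among them.\<close>
    have "v \<in> delta_set A a T"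
      using T(2) v unfolding delta_set_def by blast
    then have "v' \<in> delta_set A a T"
      using stable[OF S(1) T(1)] a S unfolding forward_stable_wrt_def by blast
    then show ?thesis
      using T unfolding delta_set_def fs_equiv_def part_equiv_def by blast
  qed
  then show ?thesis
    unfolding forward_stable_equiv_def
    using part_equiv_equiv[OF P] by (simp add: fs_equiv_def)
qed

text \<open>The passage back from pairs to parts, for comparing \<open>r\<close> with the coarsest
  partition. One \<open>a\<close>-edge from \<open>T\<close> into \<open>S\<close> is transported to
  every element of \<open>S\<close>, and the new sources stay in \<open>T\<close> because a class is
  closed under \<open>r\<close>.\<close>

lemma forward_stable_partition_quotient:
  assumes r: "forward_stable_equiv A r"
  shows "forward_stable_partition A (states A // r)"
proof -
  have eq: "equiv (states A) r"
    using r unfolding forward_stable_equiv_def by blast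
  have "S \<subseteq> delta_set A a T"
    if S: "S \<in> states A // r" and T: "T \<in> states A // r" and a: "a \<in> alphabet A"
      and ne: "S \<inter> delta_set A a T \<noteq> {}" for S T a
  proof
    fix v' assume v': "v' \<in> S"
    obtain u v where uv: "v \<in> S" "u \<in> T" "v \<in> delta A u a"
      using ne unfolding delta_set_def by blast
    have "u \<in> states A" "(v, v') \<in> r"
      using in_quotient_imp_subset[OF eq T] uv(2) quotient_eq_iff[OF eq S S uv(1) v'] by blast+
    then obtain u' where "(u, u') \<in> r" "v' \<in> delta A u' a"
      using forward_stable_equivE[OF r a _ uv(3)] by blast
    then show "v' \<in> delta_set A a T"
      using in_quotient_imp_closed[OF eq T uv(2)] unfolding delta_set_def by blast
  qed
  then show ?thesis
    unfolding forward_stable_partition_def forward_stable_wrt_def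
    using partition_on_quotient[OF eq] by blast
qed

text \<open>Coarseness as maximality among equivalences: the classes of \<open>r\<close> form a
  forward-stable partition, which therefore refines the coarsest one.\<close>

lemma forward_stable_equiv_subset_fs_equiv:
  assumes r: "forward_stable_equiv A r"
  shows "r \<subseteq> fs_equiv A"
proof (rule subrelI)
  fix u v assume uv: "(u, v) \<in> r"
  have eq: "equiv (states A) r"
    using r unfolding forward_stable_equiv_def by blast
  have u: "u \<in> states A" "u \<in> r `` {u}"
    using uv eq unfolding equiv_def refl_on_def by blast+
  have "refines (states A) (states A // r) (coarsest_fs_partition A)"
    using forward_stable_partition_quotient[OF r] is_coarsest_fs_partition_coarsest[of A]
    unfolding is_coarsest_fs_partition_def by blast
  then obtain X where "X \<in> coarsest_fs_partition A" "r `` {u} \<subseteq> X"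
    using quotientI[OF u(1)] unfolding refines_def by blast
  then show "(u, v) \<in> fs_equiv A"
    using uv u unfolding fs_equiv_def part_equiv_def by blast
qed

section \<open>The quotient automaton and its standing assumptions\<close>

lemma states_quotient_nfa [simp]: "states (quotient_nfa A r) = states A // r"
  and alphabet_quotient_nfa [simp]: "alphabet (quotient_nfa A r) = alphabet A"
  and start_quotient_nfa [simp]: "start (quotient_nfa A r) = r `` {start A}"
  by (simp_all add: quotient_nfa_def)

lemma delta_quotient_nfa_iff:
  "Y \<in> delta (quotient_nfa A r) X a \<longleftrightarrow>
     Y \<in> states A // r \<and> (\<exists>u\<in>X. \<exists>v\<in>Y. v \<in> delta A u a)"
  by (simp add: quotient_nfa_def)

lemma delta_quotient_nfaI:
  assumes "equiv (states A) r" "u \<in> states A" "v \<in> states A" "v \<in> delta A u a"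
  shows "r `` {v} \<in> delta (quotient_nfa A r) (r `` {u}) a"
  using assms(4) equiv_class_self[OF assms(1,2)] equiv_class_self[OF assms(1,3)]
    quotientI[OF assms(3)]
  unfolding delta_quotient_nfa_iff by blast

lemma is_nfa_delta:
  "is_nfa A \<Longrightarrow> u \<in> states A \<Longrightarrow> a \<in> alphabet A \<Longrightarrow> v \<in> delta A u a \<Longrightarrow> v \<in> states A"
  unfolding is_nfa_def by blast

lemma is_nfa_start_not_delta:
  "is_nfa A \<Longrightarrow> u \<in> states A \<Longrightarrow> a \<in> alphabet A \<Longrightarrow> start A \<notin> delta A u a"
  unfolding is_nfa_def by blast

lemma is_nfa_incoming:
  assumes "is_nfa A" "v \<in> states A" "v \<noteq> start A"
  obtains u a where "u \<in> states A" "a \<in> alphabet A" "v \<in> delta A u a"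
proof -
  have "(start A, v) \<in> (edge_rel A)\<^sup>*"
    using assms unfolding is_nfa_def by blast
  \<comment> \<open>The last edge of a path from the start enters \<open>v\<close>; the empty path
    is excluded by \<open>v \<noteq> start A\<close>.\<close>
  then show thesis
    by (cases rule: rtranclE) (use assms(3) that in \<open>auto simp: edge_rel_def\<close>)
qed

text \<open>Stability would carry an edge entering \<open>v\<close> over to an edge entering the
  start state, which has none.\<close>

lemma fs_class_start:
  assumes A: "is_nfa A" and r: "forward_stable_equiv A r" and v: "(start A, v) \<in> r"
  shows "v = start A"
proof (rule ccontr)
  assume ne: "v \<noteq> start A"
  have v': "v \<in> states A" "(v, start A) \<in> r"
    using r v unfolding forward_stable_equiv_def equiv_def sym_def by blast+
  obtain u a where "u \<in> states A" "a \<in> alphabet A" "v \<in> delta A u a"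
    using is_nfa_incoming[OF A v'(1) ne] .
  then obtain u' where "u' \<in> states A" "start A \<in> delta A u' a" "a \<in> alphabet A"
    using forward_stable_equivE[OF r _ _ _ v'(2)] by metis
  then show False
    using is_nfa_start_not_delta[OF A] by blast
qed

text \<open>Makes the general results on co-lex relations applicable to the quotient. Edges and
  paths project to classes; stability enters through the class of the start state.\<close>

lemma is_nfa_quotient:
  assumes A: "is_nfa A" and r: "forward_stable_equiv A r"
  shows "is_nfa (quotient_nfa A r)"
proof -
  let ?B = "quotient_nfa A r"
  have eq: "equiv (states A) r"
    using r unfolding forward_stable_equiv_def by blast
  have fin: "finite (states A // r)"
    using A eq finite_quotient unfolding is_nfa_def equiv_def by fastforce
  have s: "start A \<in> states A"
    using A unfolding is_nfa_def by blast
  \<comment> \<open>With a singleton start class, an edge of the quotient into it would come from an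
    edge of \<open>A\<close> into \<open>start A\<close>.\<close>
  have start: "r `` {start A} = {start A}"
    using fs_class_start[OF A r] equiv_class_self[OF eq s] by blast
  have reach: "(r `` {start A}, r `` {u}) \<in> (edge_rel ?B)\<^sup>*"
    if "(start A, u) \<in> (edge_rel A)\<^sup>*" for u
    using that
  proof (induction rule: rtrancl_induct)
    case base
    show ?case by simp
  next
    case (step y z)
    then have "(r `` {y}, r `` {z}) \<in> edge_rel ?B"
      unfolding edge_rel_def
      using delta_quotient_nfaI[OF eq] is_nfa_delta[OF A] quotientI[of y "states A" r] by fastforce
    with step.IH show ?case by simp
  qed
  have "(r `` {start A}, X) \<in> (edge_rel ?B)\<^sup>*" if "X \<in> states A // r" for X
    using that reach A unfolding is_nfa_def by (elim quotientE) blast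
  moreover have "\<exists>X\<in>states A // r. delta ?B X a \<noteq> {}" if a: "a \<in> alphabet A" for a
  proof -
    obtain u v where "u \<in> states A" "v \<in> delta A u a"
      using A a unfolding is_nfa_def by blast
    then show ?thesis
      using delta_quotient_nfaI[OF eq] is_nfa_delta[OF A _ a] quotientI[of u "states A" r] by blast
  qed
  moreover have "r `` {start A} \<notin> delta ?B X a"
    if X: "X \<in> states A // r" and a: "a \<in> alphabet A" for X a
    using is_nfa_start_not_delta[OF A _ a] in_quotient_imp_subset[OF eq X]
    unfolding delta_quotient_nfa_iff start by blast
  ultimately show ?thesis
    unfolding is_nfa_def using fin A s
    by (auto simp: quotientI delta_quotient_nfa_iff is_nfa_def)
qed

section \<open>Label sets and squeezing\<close>

lemma in_labels_nonempty:
  assumes "is_nfa A" "v \<in> states A"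
  shows "in_labels A v \<noteq> {}"
proof (cases "v = start A")
  case False
  obtain u a where "u \<in> states A" "a \<in> alphabet A" "v \<in> delta A u a"
    using is_nfa_incoming[OF assms False] .
  then show ?thesis
    using False unfolding in_labels_def by auto
qed (simp add: in_labels_def)

lemma in_labels_delta:
  assumes "is_nfa A" "u \<in> states A" "a \<in> alphabet A" "v \<in> delta A u a"
  shows "Some a \<in> in_labels A v"
  using assms is_nfa_start_not_delta[OF assms(1-3)] unfolding in_labels_def by auto

text \<open>An element of \<open>M\<close> is the pivot; with \<open>M\<close> empty both
  comparisons would hold vacuously.\<close>

lemma labels_le_trans: "labels_le L M \<Longrightarrow> labels_le M N \<Longrightarrow> M \<noteq> {} \<Longrightarrow> labels_le L N"
  unfolding labels_le_def by (meson equals0I order_trans)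

text \<open>Both \<open>u\<close> and \<open>w\<close> carry the label \<open>Some a\<close>, so any
  label of \<open>v\<close> is bounded by \<open>Some a\<close> from both sides, and
  \<open>v\<close> has at least one label.\<close>

lemma incoming_between:
  assumes A: "is_nfa A" and a: "a \<in> alphabet A" and v: "v \<in> states A"
    and u: "u' \<in> states A" "u \<in> delta A u' a" and w: "w' \<in> states A" "w \<in> delta A w' a"
    and le: "labels_le (in_labels A u) (in_labels A v)" "labels_le (in_labels A v) (in_labels A w)"
  obtains v' where "v' \<in> states A" "v \<in> delta A v' a"
proof -
  obtain x where x: "x \<in> in_labels A v"
    using in_labels_nonempty[OF A v] by blast
  then have "Some a \<le> x" "x \<le> Some a"
    using le in_labels_delta[OF A u(1) a u(2)] in_labels_delta[OF A w(1) a w(2)]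
    unfolding labels_le_def by blast+
  then have "Some a \<in> in_labels A v"
    using x by (metis order_antisym)
  \<comment> \<open>The start state carries only \<open>None\<close>, so the label
    \<open>Some a\<close> comes from an actual edge.\<close>
  then show thesis
    using that unfolding in_labels_def by (auto split: if_splits)
qed

section \<open>Co-lex relations and co-lex orders\<close>

lemma colex_relation_labels:
  "colex_relation A R \<Longrightarrow> (u, v) \<in> R \<Longrightarrow> u \<noteq> v \<Longrightarrow> labels_le (in_labels A u) (in_labels A v)"
  unfolding colex_relation_def by blast

lemma colex_relation_pred:
  "colex_relation A R \<Longrightarrow> (u, v) \<in> R \<Longrightarrow> u \<noteq> v \<Longrightarrow> a \<in> alphabet A \<Longrightarrow>
    u' \<in> states A \<Longrightarrow> v' \<in> states A \<Longrightarrow> u \<in> delta A u' a \<Longrightarrow> v \<in> delta A v' a \<Longrightarrow> (u', v') \<in> R"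
  unfolding colex_relation_def by blast

lemma colex_relation_subset: "colex_relation A R \<Longrightarrow> R \<subseteq> states A \<times> states A"
  and colex_relation_refl: "colex_relation A R \<Longrightarrow> refl_on (states A) R"
  unfolding colex_relation_def by blast+

lemma colex_relationI:
  assumes "R \<subseteq> states A \<times> states A" "refl_on (states A) R"
    and "\<And>u v. (u, v) \<in> R \<Longrightarrow> u \<noteq> v \<Longrightarrow> labels_le (in_labels A u) (in_labels A v)"
    and "\<And>a u' v' u v. a \<in> alphabet A \<Longrightarrow> u' \<in> states A \<Longrightarrow> v' \<in> states A \<Longrightarrow>
      u \<in> delta A u' a \<Longrightarrow> v \<in> delta A v' a \<Longrightarrow> (u, v) \<in> R \<Longrightarrow> u \<noteq> v \<Longrightarrow> (u', v') \<in> R"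
  shows "colex_relation A R"
  unfolding colex_relation_def using assms by simp

text \<open>Each co-lex condition starts from a single related pair and never demands that a pair be
  absent, so it survives unions.\<close>

lemma colex_relation_maximum: "colex_relation A (maximum_colex_relation A)"
proof -
  \<comment> \<open>The identity is one of the united relations, which makes the union
    reflexive.\<close>
  have "colex_relation A (Id_on (states A))"
    unfolding colex_relation_def by (auto simp: refl_on_def)
  then have refl: "refl_on (states A) (maximum_colex_relation A)"
    using colex_relation_refl unfolding maximum_colex_relation_def refl_on_def by blast
  show ?thesis
  proof (rule colex_relationI[OF _ refl])
    show "maximum_colex_relation A \<subseteq> states A \<times> states A"
      using colex_relation_subset unfolding maximum_colex_relation_def by blast
  next
    fix u v assume "(u, v) \<in> maximum_colex_relation A" "u \<noteq> v"
    then obtain R where "colex_relation A R" "(u, v) \<in> R"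
      unfolding maximum_colex_relation_def by blast
    then show "labels_le (in_labels A u) (in_labels A v)"
      using \<open>u \<noteq> v\<close> by (rule colex_relation_labels)
  next
    fix a u' v' u v
    assume step: "a \<in> alphabet A" "u' \<in> states A" "v' \<in> states A" "u \<in> delta A u' a"
      "v \<in> delta A v' a" and uv: "(u, v) \<in> maximum_colex_relation A" "u \<noteq> v"
    obtain R where R: "colex_relation A R" "(u, v) \<in> R"
      using uv unfolding maximum_colex_relation_def by blast
    then show "(u', v') \<in> maximum_colex_relation A"
      using colex_relation_pred[OF R uv(2) step] unfolding maximum_colex_relation_def by blast
  qed
qed

lemma colex_relation_relcomp:
  assumes A: "is_nfa A" and R: "colex_relation A R" and S: "colex_relation A S"
  shows "colex_relation A (R O S)"
  unfolding colex_relation_def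
proof (intro conjI allI ballI impI; (elim conjE relcompEpair)?)
  show "R O S \<subseteq> states A \<times> states A" "refl_on (states A) (R O S)"
    using colex_relation_subset[OF R] colex_relation_subset[OF S]
      colex_relation_refl[OF R] colex_relation_refl[OF S]
    unfolding refl_on_def by blast+
next
  fix u v w assume "u \<noteq> w" and uv: "(u, v) \<in> R" and vw: "(v, w) \<in> S"
  have "v \<in> states A"
    using uv colex_relation_subset[OF R] by blast
  then show "labels_le (in_labels A u) (in_labels A w)"
    using labels_le_trans[OF colex_relation_labels[OF R uv] colex_relation_labels[OF S vw]]
      colex_relation_labels[OF R uv] colex_relation_labels[OF S vw]
      in_labels_nonempty[OF A] \<open>u \<noteq> w\<close> by blast
next
  fix a u' w' u w v
  assume a: "a \<in> alphabet A" and u': "u' \<in> states A" and w': "w' \<in> states A"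
    and u: "u \<in> delta A u' a" and w: "w \<in> delta A w' a"
    and "u \<noteq> w" and uv: "(u, v) \<in> R" and vw: "(v, w) \<in> S"
  have v: "v \<in> states A"
    using uv colex_relation_subset[OF R] by blast
  have refl: "(x, x) \<in> R" "(x, x) \<in> S" if "x \<in> states A" for x
    using that colex_relation_refl[OF R] colex_relation_refl[OF S] unfolding refl_on_def by blast+
  \<comment> \<open>If the middle state is an endpoint, one relation moves the pair back and
    reflexivity of the other supplies the missing factor. Otherwise \<open>v\<close> is squeezed and
    gets an \<open>a\<close>-predecessor \<open>v'\<close>, through which \<open>(u', w')\<close>
    factors.\<close>
  consider "u = v" "v \<noteq> w" | "v = w" "u \<noteq> v" | "u \<noteq> v" "v \<noteq> w"
    using \<open>u \<noteq> w\<close> by blast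
  then show "(u', w') \<in> R O S"
  proof cases
    case 1
    then show ?thesis
      using colex_relation_pred[OF S vw _ a u' w'] u w refl u' by blast
  next
    case 2
    then show ?thesis
      using colex_relation_pred[OF R uv _ a u' w'] u w refl w' by blast
  next
    case 3
    obtain v' where v': "v' \<in> states A" "v \<in> delta A v' a"
      using incoming_between[OF A a v u' u w' w colex_relation_labels[OF R uv 3(1)]
          colex_relation_labels[OF S vw 3(2)]] .
    then show ?thesis
      using colex_relation_pred[OF R uv 3(1) a u' v'(1) u v'(2)]
        colex_relation_pred[OF S vw 3(2) a v'(1) w' v'(2) w] by blast
  qed
qed

text \<open>The self-composition is a co-lex relation, hence contained in the union of all of
  them.\<close>

lemma trans_maximum_colex_relation:
  assumes "is_nfa A"
  shows "trans (maximum_colex_relation A)"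
  using colex_relation_relcomp[OF assms colex_relation_maximum colex_relation_maximum]
  unfolding maximum_colex_relation_def trans_def by blast

text \<open>By antisymmetry distinct related states are strictly related, so conditions on strict
  pairs reach all distinct pairs. Hence the maximum co-lex relation contains every co-lex
  order.\<close>

lemma colex_order_imp_colex_relation:
  assumes "colex_order A R"
  shows "colex_relation A R"
proof -
  have po: "partial_order_on (states A) R"
    using assms unfolding colex_order_def by blast
  have strict: "(v, u) \<notin> R" if "(u, v) \<in> R" "u \<noteq> v" for u v
    using that po unfolding partial_order_on_def antisym_def by blast
  show ?thesis
  proof (rule colex_relationI)
    show "R \<subseteq> states A \<times> states A" "refl_on (states A) R"
      using po unfolding partial_order_on_def preorder_on_def by blast+
  next
    fix u v assume "(u, v) \<in> R" "u \<noteq> v"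
    then show "labels_le (in_labels A u) (in_labels A v)"
      using assms strict unfolding colex_order_def by blast
  next
    fix a u' v' u v
    assume "a \<in> alphabet A" "u' \<in> states A" "v' \<in> states A" "u \<in> delta A u' a"
      "v \<in> delta A v' a" "(u, v) \<in> R" "u \<noteq> v"
    then show "(u', v') \<in> R"
      using assms strict[of u v] unfolding colex_order_def by blast
  qed
qed

text \<open>A strictly related pair is distinct, so the order conditions are instances of the
  relation conditions. The maximum co-lex relation is then itself a co-lex order above all others,
  hence equal to their union.\<close>

lemma maximum_colex_order_if_antisym:
  assumes A: "is_nfa A" and anti: "antisym (maximum_colex_relation A)"
  shows "maximum_colex_order A (maximum_colex_relation A)"
proof -
  let ?M = "maximum_colex_relation A"
  have M: "colex_relation A ?M"
    by (rule colex_relation_maximum)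
  have "colex_order A ?M"
    unfolding colex_order_def
  proof (intro conjI allI ballI impI; (elim conjE)?)
    show "partial_order_on (states A) ?M"
      using anti trans_maximum_colex_relation[OF A] colex_relation_subset[OF M]
        colex_relation_refl[OF M]
      unfolding partial_order_on_def preorder_on_def by blast
  next
    fix u v assume "(u, v) \<in> ?M" "(v, u) \<notin> ?M"
    then show "labels_le (in_labels A u) (in_labels A v)"
      using colex_relation_labels[OF M] by blast
  next
    fix a u' v' u v
    assume "a \<in> alphabet A" "u' \<in> states A" "v' \<in> states A" "u \<in> delta A u' a"
      "v \<in> delta A v' a" "(u, v) \<in> ?M" "(v, u) \<notin> ?M"
    then show "(u', v') \<in> ?M"
      using colex_relation_pred[OF M] by blast
  qed
  moreover have "R \<subseteq> ?M" if "colex_order A R" for R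
    using colex_order_imp_colex_relation[OF that] unfolding maximum_colex_relation_def by blast
  ultimately show ?thesis
    unfolding maximum_colex_order_def by blast
qed

section \<open>Mutual comparability of classes, pulled back to the original states\<close>

text \<open>Within one class, stability of \<open>r\<close> provides the required edge; between
  distinct classes a predecessor is found in the quotient and then lifted to
  \<open>A\<close>.\<close>

lemma forward_stable_equiv_pullback:
  assumes A: "is_nfa A" and r: "forward_stable_equiv A r"
    and M: "colex_relation (quotient_nfa A r) M" and tr: "trans M"
  shows "forward_stable_equiv A
    {(u, v). u \<in> states A \<and> v \<in> states A \<and>
      (r `` {u}, r `` {v}) \<in> M \<and> (r `` {v}, r `` {u}) \<in> M}" (is "forward_stable_equiv A ?E")
proof -
  let ?B = "quotient_nfa A r"
  note B = is_nfa_quotient[OF A r]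
  have eq: "equiv (states A) r"
    using r unfolding forward_stable_equiv_def by blast
  have reflM: "(r `` {u}, r `` {u}) \<in> M" if "u \<in> states A" for u
    using colex_relation_refl[OF M] quotientI[OF that] unfolding refl_on_def by simp
  have "equiv (states A) ?E"
  proof (rule equivI)
    show "refl_on (states A) ?E"
      using reflM by (auto simp: refl_on_def)
    show "trans ?E"
      using tr unfolding trans_def by blast
  qed (auto simp: sym_def)
  moreover have "\<exists>u'. (u, u') \<in> ?E \<and> v' \<in> delta A u' a"
    if a: "a \<in> alphabet A" and u: "u \<in> states A" and v: "v \<in> delta A u a"
      and vv': "(v, v') \<in> ?E" for a u v v'
  proof (cases "r `` {v} = r `` {v'}")
    case True
    then have "(v, v') \<in> r"
      using vv' eq_equiv_class_iff[OF eq] by blast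
    then obtain u' where "(u, u') \<in> r" "u' \<in> states A" "v' \<in> delta A u' a"
      using forward_stable_equivE[OF r a u v] by blast
    \<comment> \<open>\<open>u\<close> and \<open>u'\<close> share a class, so reflexivity of
      \<open>M\<close> relates their classes both ways.\<close>
    then show ?thesis
      using u reflM equiv_class_eq[OF eq, of u u'] by auto
  next
    case False
    have vs: "v \<in> states A" "v' \<in> states A"
      and MM: "(r `` {v}, r `` {v'}) \<in> M" "(r `` {v'}, r `` {v}) \<in> M"
      using vv' by blast+
    have a': "a \<in> alphabet ?B" and U: "r `` {u} \<in> states ?B"
      and V': "r `` {v'} \<in> states ?B"
      using a u vs quotientI[of _ "states A" r] by simp_all
    have V: "r `` {v} \<in> delta ?B (r `` {u}) a"
      using delta_quotient_nfaI[OF eq u vs(1) v] .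
    \<comment> \<open>The class of \<open>v'\<close> lies both above and below that of
      \<open>v\<close>, so the latter serves as both outer ends of the squeeze.\<close>
    obtain U' where U': "U' \<in> states ?B" "r `` {v'} \<in> delta ?B U' a"
      using incoming_between[OF B a' V' U V U V colex_relation_labels[OF M MM(1) False]
        colex_relation_labels[OF M MM(2) False[symmetric]]] .
    \<comment> \<open>An edge of the quotient only reaches some representative \<open>z\<close>.
      Stability of \<open>r\<close> moves its head to \<open>v'\<close> itself while the source
      stays in \<open>U'\<close>.\<close>
    obtain w z where wz: "w \<in> U'" "(v', z) \<in> r" "z \<in> delta A w a"
      using U'(2) unfolding delta_quotient_nfa_iff by blast
    have U'q: "U' \<in> states A // r"
      using U'(1) by simp
    then obtain x where x: "U' = r `` {x}"
      by (rule quotientE)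
    have w: "w \<in> states A" "r `` {w} = U'"
      using in_quotient_imp_subset[OF eq U'q] wz(1) equiv_class_eq[OF eq, of x w] x by auto
    have "(z, v') \<in> r"
      using wz(2) eq unfolding equiv_def sym_def by blast
    then obtain u' where u': "(w, u') \<in> r" "u' \<in> states A" "v' \<in> delta A u' a"
      using forward_stable_equivE[OF r a w(1) wz(3)] by blast
    have "r `` {u'} = U'"
      using equiv_class_eq[OF eq u'(1)] w(2) by simp
    \<comment> \<open>Moving both comparisons back along \<open>a\<close> makes the class of
      \<open>u\<close> and \<open>U'\<close> mutually comparable.\<close>
    then show ?thesis
      using u u' colex_relation_pred[OF M MM(1) False a' U U'(1) V U'(2)]
        colex_relation_pred[OF M MM(2) False[symmetric] a' U'(1) U U'(2) V] by auto
  qed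
  ultimately show ?thesis
    unfolding forward_stable_equiv_def by blast
qed

theorem lemma3:
  fixes A :: "('q, 'a::linorder) nfa"
  assumes "is_nfa A"
  shows "maximum_colex_order (quotient_nfa A (fs_equiv A))
           (maximum_colex_relation (quotient_nfa A (fs_equiv A)))"
proof (rule maximum_colex_order_if_antisym)
  let ?r = "fs_equiv A"
  let ?B = "quotient_nfa A ?r"
  let ?M = "maximum_colex_relation ?B"
  note r = forward_stable_equiv_fs_equiv[of A]
  have eq: "equiv (states A) ?r"
    using r unfolding forward_stable_equiv_def by blast
  show B: "is_nfa ?B"
    using is_nfa_quotient[OF assms r] .
  show "antisym ?M"
  proof (rule antisymI)
    fix X Y assume XY: "(X, Y) \<in> ?M" "(Y, X) \<in> ?M"
    then have "X \<in> states A // ?r" "Y \<in> states A // ?r"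
      using colex_relation_subset[OF colex_relation_maximum, of ?B] by auto
    then obtain x y where xy: "x \<in> states A" "X = ?r `` {x}" "y \<in> states A" "Y = ?r `` {y}"
      by (elim quotientE)
    \<comment> \<open>The pulled-back equivalence for \<open>?M\<close> contains
      \<open>(x, y)\<close> and lies below \<open>?r\<close> by maximality.\<close>
    have "(x, y) \<in> ?r"
      using forward_stable_equiv_subset_fs_equiv[OF forward_stable_equiv_pullback[OF assms r
            colex_relation_maximum trans_maximum_colex_relation[OF B]]] XY xy by blast
    then show "X = Y"
      using xy equiv_class_eq[OF eq] by simp
  qed
qed

end
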